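(* Let $X\sim\mathrm{G}(\alpha,\theta)$ with known $\alpha>0$ and unknown $\theta\in\mathbb{R}_+$ (positive), and let $m\neq0$ with $\alpha>2m$. Let $k=\big\{\frac{\Gamma(\alpha)}{\Gamma(\alpha-m)}\big\}^{1/m}$ and consider the first-stage loss $\rho_m\big(\frac{\hat\theta}{\theta}\big)$, $\rho_m(t)=t^m-m\log t-1$, incurred by $\hat\theta_{\pi_0}(X)=\frac kX$, namely $$L=\Big(\frac{k}{\theta X}\Big)^m-m\log\Big(\frac{k}{\theta X}\Big)-1 .$$ For estimating $L$ under second-stage squared error loss $(\hat L-L)^2$, the generalized Bayes estimator (with respect to the improper prior density $\pi_0(\theta)=\frac1\theta$ on $(0,\infty)$) $$\hat L_{\pi_0}(X)=m\,\Psi(\alpha)+\log\Big(\frac{\Gamma(\alpha-m)}{\Gamma(\alpha)}\Big)$$ is minimax, with minimax risk equal to $$k^{2m}\Big\{\frac{\Gamma(\alpha-2m)}{\Gamma(\alpha)}-\Big(\frac{\Gamma(\alpha-m)}{\Gamma(\alpha)}\Big)^2\Big\}+m^2\,\Psi'(\alpha)+2m\,k^m\,\frac{\Gamma(\alpha-m)}{\Gamma(\alpha)}\big\{\Psi(\alpha-m)-\Psi(\alpha)\big\}.$$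
   Context: $\mathrm{G}(a,b)$ is the Gamma distribution with density proportional to $t^{a-1}e^{-bt}$ on $(0,\infty)$. $\Gamma$ is the Gamma function and $\Psi(t)=\frac{d}{dt}\log\Gamma(t)$ the Digamma function. The frequentist risk of an estimator $\hat L(X)$ of $L=L(\theta,X)$ is $R(\theta,\hat L)=\mathbb{E}_\theta\big((\hat L(X)-L)^2\big)$. An estimator $\hat L_0(X)$ is minimax if $\sup_\theta R(\theta,\hat L_0)=\inf_{\hat L}\sup_\theta R(\theta,\hat L)$; this common value is the minimax risk. *)

theory Defs
  imports "HOL-Probability.Probability"
begin

text \<open>The second parameter is a rate: the density is proportional to \<open>t powr (a - 1) * exp (- b * t)\<close>.\<close>

definition gamma_density :: "real \<Rightarrow> real \<Rightarrow> real \<Rightarrow> real" where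
  "gamma_density a b t =
     (if t > 0 then b powr a / Gamma a * t powr (a - 1) * exp (- b * t) else 0)"

definition gamma_distribution :: "real \<Rightarrow> real \<Rightarrow> real measure" where
  "gamma_distribution a b = density lborel (\<lambda>t. ennreal (gamma_density a b t))"

lemma gamma_density_nonneg: "a > 0 \<Longrightarrow> gamma_density a b t \<ge> 0"
  by (auto simp: gamma_density_def intro!: mult_nonneg_nonneg divide_nonneg_pos)

lemma gamma_density_measurable [measurable]: "gamma_density a b \<in> borel_measurable borel"
  unfolding gamma_density_def by measurable

lemma prob_space_gamma_distribution:
  assumes "a > 0" "b > 0"
  shows "prob_space (gamma_distribution a b)"
proof
  have "(\<integral>\<^sup>+t. ennreal (gamma_density a b t) \<partial>lborel)
      = ennreal \<bar>1 / b\<bar> * (\<integral>\<^sup>+t. ennreal (gamma_density a b (0 + 1 / b * t)) \<partial>lborel)"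
    using assms by (intro nn_integral_real_affine) auto
  also have "(\<integral>\<^sup>+t. ennreal (gamma_density a b (0 + 1 / b * t)) \<partial>lborel)
      = (\<integral>\<^sup>+t. ennreal (b / Gamma a) * ennreal (indicator {0..} t * t powr (a - 1) / exp t) \<partial>lborel)"
    using assms
    by (intro nn_integral_cong)
       (auto simp: gamma_density_def indicator_def ennreal_mult' [symmetric] powr_divide
             powr_diff exp_minus field_simps)
  also have "\<dots> = ennreal (b / Gamma a) * ennreal (Gamma a)"
    using assms Gamma_conv_nn_integral_real[of a] by (subst nn_integral_cmult) auto
  also have "\<dots> = ennreal b"
    using assms Gamma_real_pos[of a] by (simp add: ennreal_mult' [symmetric] less_imp_neq [symmetric])
  also have "ennreal \<bar>1 / b\<bar> * ennreal b = 1"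
    using assms by (simp add: ennreal_mult' [symmetric])
  finally show "emeasure (gamma_distribution a b) (space (gamma_distribution a b)) = 1"
    by (simp add: gamma_distribution_def emeasure_density)
qed

definition rho :: "real \<Rightarrow> real \<Rightarrow> real" where
  "rho m t = t powr m - m * ln t - 1"

text \<open>
  Decision problem with real observations: \<open>P \<theta>\<close> is the law of the observation under \<open>\<theta>\<close>, and
  \<open>L \<theta> x\<close> is the (parameter- and data-dependent) quantity being estimated. The risk takes
  extended values, so estimators of infinite risk are admitted as competitors.
\<close>

definition risk :: "('p \<Rightarrow> real measure) \<Rightarrow> ('p \<Rightarrow> real \<Rightarrow> real) \<Rightarrow> 'p \<Rightarrow> (real \<Rightarrow> real) \<Rightarrow> ennreal" where
  "risk P L \<theta> d = (\<integral>\<^sup>+x. ennreal ((d x - L \<theta> x)\<^sup>2) \<partial>P \<theta>)"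

definition minimax_risk :: "('p \<Rightarrow> real measure) \<Rightarrow> ('p \<Rightarrow> real \<Rightarrow> real) \<Rightarrow> 'p set \<Rightarrow> ennreal" where
  "minimax_risk P L \<Theta> = (INF d\<in>borel_measurable borel. SUP \<theta>\<in>\<Theta>. risk P L \<theta> d)"

definition is_minimax ::
    "('p \<Rightarrow> real measure) \<Rightarrow> ('p \<Rightarrow> real \<Rightarrow> real) \<Rightarrow> 'p set \<Rightarrow> (real \<Rightarrow> real) \<Rightarrow> bool" where
  "is_minimax P L \<Theta> d \<longleftrightarrow>
     d \<in> borel_measurable borel \<and> (SUP \<theta>\<in>\<Theta>. risk P L \<theta> d) = minimax_risk P L \<Theta>"

text \<open>
  Generalized Bayes estimation for a possibly improper prior density \<open>\<pi>\<close> on \<open>\<Theta>\<close> and a likelihood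
  \<open>f \<theta> x\<close>. The posterior must be proper and the minimal posterior expected loss finite;
  otherwise minimality could hold vacuously.
\<close>

definition marginal :: "(real \<Rightarrow> real) \<Rightarrow> (real \<Rightarrow> real \<Rightarrow> real) \<Rightarrow> real set \<Rightarrow> real \<Rightarrow> ennreal" where
  "marginal \<pi> f \<Theta> x = (\<integral>\<^sup>+\<theta>\<in>\<Theta>. ennreal (\<pi> \<theta> * f \<theta> x) \<partial>lborel)"

definition posterior :: "(real \<Rightarrow> real) \<Rightarrow> (real \<Rightarrow> real \<Rightarrow> real) \<Rightarrow> real set \<Rightarrow> real \<Rightarrow> real measure" where
  "posterior \<pi> f \<Theta> x =
     density lborel (\<lambda>\<theta>. ennreal (\<pi> \<theta> * f \<theta> x) * indicator \<Theta> \<theta> / marginal \<pi> f \<Theta> x)"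

definition posterior_loss ::
    "(real \<Rightarrow> real) \<Rightarrow> (real \<Rightarrow> real \<Rightarrow> real) \<Rightarrow> real set \<Rightarrow> (real \<Rightarrow> real \<Rightarrow> real) \<Rightarrow> real \<Rightarrow> real \<Rightarrow> ennreal" where
  "posterior_loss \<pi> f \<Theta> L x a = (\<integral>\<^sup>+\<theta>. ennreal ((a - L \<theta> x)\<^sup>2) \<partial>posterior \<pi> f \<Theta> x)"

definition is_generalized_bayes ::
    "(real \<Rightarrow> real) \<Rightarrow> (real \<Rightarrow> real \<Rightarrow> real) \<Rightarrow> real set \<Rightarrow> real set \<Rightarrow> (real \<Rightarrow> real \<Rightarrow> real) \<Rightarrow>
      (real \<Rightarrow> real) \<Rightarrow> bool" where
  "is_generalized_bayes \<pi> f \<Theta> S L d \<longleftrightarrow>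
     d \<in> borel_measurable borel \<and>
     (\<forall>x\<in>S. 0 < marginal \<pi> f \<Theta> x \<and> marginal \<pi> f \<Theta> x < \<infinity> \<and>
            posterior_loss \<pi> f \<Theta> L x (d x) < \<infinity> \<and>
            (\<forall>a. posterior_loss \<pi> f \<Theta> L x (d x) \<le> posterior_loss \<pi> f \<Theta> L x a))"

end

theory Submission
  imports Defs
begin

text \<open>
  Everything rests on one pivot. The loss \<open>L \<theta> x = g (\<theta> * x)\<close> depends on parameter and data
  only through their product, where \<open>g t = rho m (k / t)\<close>, and \<open>T = \<theta> X\<close> has the
  \<open>G(\<alpha>, 1)\<close> law whatever \<open>\<theta>\<close> is. Under the prior \<open>1 / \<theta>\<close>, the Haar measure of the
  multiplicative group, the posterior law of \<open>\<theta> * x\<close> given \<open>x\<close> is that same \<open>G(\<alpha>, 1)\<close>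
  law. So a constant estimate \<open>a\<close> has the risk \<open>E (a - g T)\<^sup>2\<close> at every \<open>\<theta>\<close>, and the
  posterior loss of \<open>a\<close> at every \<open>x\<close> is the same number. It is least for \<open>a = E (g T)\<close>,
  where it equals the variance of \<open>g T\<close>. This gives the generalized Bayes property and
  the upper bound on the minimax risk.

  For the lower bound (\<open>scale_family_minimax_lower_bound\<close>) the improper prior is approximated by
  its restrictions to \<open>[exp (-N), exp N]\<close>, of total mass \<open>2 N\<close>. Averaging the risk of any
  estimator over this window and exchanging the integrals leaves, for each observation \<open>x\<close>, an
  integral over \<open>t = \<theta> * x\<close>. If \<open>x\<close> lies in the window shrunk by the factor \<open>exp K\<close> at
  both ends, this integral covers all of \<open>[exp (-K), exp K]\<close>, and therefore is at least the
  smallest square loss for \<open>g T\<close> truncated to that interval. The shrunk window has mass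
  \<open>2 (N - K)\<close>, a proportion of the whole that tends to 1 as \<open>N\<close> grows, so no
  estimator has a maximal risk below the truncated optimum; as \<open>K\<close> grows, that optimum rises to
  the variance. The argument is valid for every scale family on the positive half-line in which
  \<open>g T\<close> has a finite second moment.

  It remains to evaluate the mean and variance of \<open>g T\<close>, which is \<open>k powr m * T powr (-m) +
  m * ln T\<close> up to a constant. The moments of \<open>ln T\<close>, alone or weighted by a power of \<open>T\<close>,
  are derivatives of the power moment \<open>s \<mapsto> E (T powr s) = Gamma (\<alpha> + s) / Gamma \<alpha>\<close>;
  differentiating under the integral sign brings in the Digamma function
  (\<open>log_gamma_moments\<close>). The constant \<open>k\<close> is chosen so that
  \<open>k powr m * E (T powr (-m)) = 1\<close>.
\<close>

section \<open>Differentiating exponential moments\<close>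

lemma power_le_fact_exp:
  fixes x :: real assumes "x \<ge> 0" shows "x ^ n \<le> fact n * exp x"
proof -
  have "(\<Sum>k\<in>{n}. inverse (fact k) * x ^ k) \<le> (\<Sum>k. inverse (fact k) * x ^ k)"
    using assms summable_exp[of x] by (intro sum_le_suminf) auto
  then show ?thesis
    by (simp add: exp_def divide_simps mult.commute)
qed

lemma exp_abs_le: "exp \<bar>x\<bar> \<le> exp x + exp (- x)" for x :: real
  by (cases "x \<ge> 0") (auto simp: abs_if)

lemma abs_exp_minus_one_le: "\<bar>exp x - 1\<bar> \<le> \<bar>x\<bar> * exp \<bar>x\<bar>" for x :: real
proof (cases "x \<ge> 0")
  case True
  have "(1 - x) * exp x \<le> exp (- x) * exp x"
    using exp_ge_add_one_self[of "- x"] by (intro mult_right_mono) auto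
  then have "(1 - x) * exp x \<le> 1" by (simp add: exp_minus)
  then show ?thesis using True by (simp add: algebra_simps)
next
  case False
  then have "exp x \<le> 1" by simp
  then have "\<bar>exp x - 1\<bar> \<le> \<bar>x\<bar> * 1"
    using exp_ge_add_one_self[of x] by linarith
  also have "\<dots> \<le> \<bar>x\<bar> * exp \<bar>x\<bar>"
    by (intro mult_left_mono) auto
  finally show ?thesis .
qed

text \<open>A power of \<open>Y\<close> costs only a factor \<open>exp (\<delta> * \<bar>Y\<bar>)\<close> with \<open>\<delta>\<close> arbitrarily small,
  and this is absorbed by moving \<open>s\<close> a little inside the open set on which the exponential
  moment exists.\<close>

lemma integrable_power_exp:
  fixes Y :: "'a \<Rightarrow> real"
  assumes [measurable]: "Y \<in> borel_measurable M"
    and mgf: "\<And>s. s \<in> S \<Longrightarrow> integrable M (\<lambda>x. exp (s * Y x))"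
    and S: "open S" "s \<in> S"
  shows "integrable M (\<lambda>x. \<bar>Y x\<bar> ^ n * exp (s * Y x))"
proof -
  obtain \<delta> where \<delta>: "\<delta> > 0" "cball s \<delta> \<subseteq> S"
    using S open_contains_cball by blast
  then have "s + \<delta> \<in> S" "s - \<delta> \<in> S" by (auto simp: dist_real_def subset_iff)
  then have "integrable M (\<lambda>x. fact n / \<delta> ^ n * (exp ((s + \<delta>) * Y x) + exp ((s - \<delta>) * Y x)))"
    by (intro integrable_mult_right Bochner_Integration.integrable_add mgf)
  then show ?thesis
  proof (rule Bochner_Integration.integrable_bound)
    show "AE x in M. norm (\<bar>Y x\<bar> ^ n * exp (s * Y x))
        \<le> norm (fact n / \<delta> ^ n * (exp ((s + \<delta>) * Y x) + exp ((s - \<delta>) * Y x)))"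
    proof (rule AE_I2)
      fix x
      have "\<delta> ^ n * \<bar>Y x\<bar> ^ n = \<bar>\<delta> * Y x\<bar> ^ n"
        using \<delta> by (simp add: abs_mult power_mult_distrib)
      also have "\<dots> \<le> fact n * exp \<bar>\<delta> * Y x\<bar>"
        by (rule power_le_fact_exp) simp
      also have "\<dots> \<le> fact n * (exp (\<delta> * Y x) + exp (- (\<delta> * Y x)))"
        by (intro mult_left_mono exp_abs_le) auto
      finally have "\<bar>Y x\<bar> ^ n \<le> fact n / \<delta> ^ n * (exp (\<delta> * Y x) + exp (- (\<delta> * Y x)))"
        using \<delta> by (simp add: field_simps)
      then have "\<bar>Y x\<bar> ^ n * exp (s * Y x)
          \<le> fact n / \<delta> ^ n * (exp (\<delta> * Y x) + exp (- (\<delta> * Y x))) * exp (s * Y x)"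
        by (intro mult_right_mono) auto
      also have "\<dots> = fact n / \<delta> ^ n * (exp ((s + \<delta>) * Y x) + exp ((s - \<delta>) * Y x))"
        by (simp add: algebra_simps flip: exp_add)
      finally show "norm (\<bar>Y x\<bar> ^ n * exp (s * Y x))
          \<le> norm (fact n / \<delta> ^ n * (exp ((s + \<delta>) * Y x) + exp ((s - \<delta>) * Y x)))"
        using \<delta> by (simp add: abs_mult)
    qed
  qed measurable
qed

text \<open>Dominated convergence applies to the difference quotients: \<open>\<bar>exp (h * Y) - 1\<bar>\<close> is at most
  \<open>\<bar>h * Y\<bar> * exp \<bar>h * Y\<bar>\<close>, so for \<open>\<bar>h\<bar> \<le> \<delta>\<close> their integrands are dominated by those
  of the next absolute moments at \<open>s + \<delta>\<close> and \<open>s - \<delta>\<close>.\<close>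

lemma has_real_derivative_integral_power_exp:
  fixes Y :: "'a \<Rightarrow> real"
  assumes [measurable]: "Y \<in> borel_measurable M"
    and mgf: "\<And>s. s \<in> S \<Longrightarrow> integrable M (\<lambda>x. exp (s * Y x))"
    and S: "open S" "s \<in> S"
  shows "((\<lambda>s. \<integral>x. Y x ^ n * exp (s * Y x) \<partial>M)
     has_real_derivative (\<integral>x. Y x ^ Suc n * exp (s * Y x) \<partial>M)) (at s)"
proof -
  obtain \<delta> where \<delta>: "\<delta> > 0" "cball s \<delta> \<subseteq> S"
    using S open_contains_cball by blast
  then have S': "s + h \<in> S" if "\<bar>h\<bar> \<le> \<delta>" for h
    using that by (auto simp: dist_real_def subset_iff)
  have int: "integrable M (\<lambda>x. Y x ^ j * exp (r * Y x))" if "r \<in> S" for j r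
    using integrable_power_exp[OF assms(1) mgf S(1) that, of j]
    by (rule Bochner_Integration.integrable_bound) (auto simp: abs_mult power_abs)
  let ?q = "\<lambda>h x. (Y x ^ n * exp ((s + h) * Y x) - Y x ^ n * exp (s * Y x)) / h"
  have lim: "((\<lambda>h. \<integral>x. ?q h x \<partial>M) \<longlongrightarrow> (\<integral>x. Y x ^ Suc n * exp (s * Y x) \<partial>M)) (at 0)"
    unfolding tendsto_at_iff_sequentially
  proof (intro allI impI)
    fix X :: "nat \<Rightarrow> real" assume X: "\<forall>i. X i \<in> UNIV - {0}" "X \<longlonglongrightarrow> 0"
    have "eventually (\<lambda>i. \<bar>X i\<bar> < \<delta>) sequentially"
      using X(2) \<delta>(1) by (auto simp: tendsto_iff dist_real_def)
    then obtain N where N: "\<And>i. i \<ge> N \<Longrightarrow> \<bar>X i\<bar> < \<delta>"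
      by (auto simp: eventually_sequentially)
    \<comment> \<open>The domination holds only for \<open>\<bar>h\<bar> \<le> \<delta>\<close>, so the first \<open>N\<close> terms are dropped.\<close>
    have "(\<lambda>i. \<integral>x. ?q (X (i + N)) x \<partial>M) \<longlonglongrightarrow> (\<integral>x. Y x ^ Suc n * exp (s * Y x) \<partial>M)"
    proof (rule integral_dominated_convergence
        [where w = "\<lambda>x. \<bar>Y x\<bar> ^ Suc n * exp ((s + \<delta>) * Y x) + \<bar>Y x\<bar> ^ Suc n * exp ((s - \<delta>) * Y x)"])
      show "integrable M (\<lambda>x. \<bar>Y x\<bar> ^ Suc n * exp ((s + \<delta>) * Y x)
          + \<bar>Y x\<bar> ^ Suc n * exp ((s - \<delta>) * Y x))"
        using S'[of \<delta>] S'[of "- \<delta>"] \<delta>(1)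
        by (intro Bochner_Integration.integrable_add integrable_power_exp[OF assms(1) mgf S(1)]) auto
      show "AE x in M. (\<lambda>i. ?q (X (i + N)) x) \<longlonglongrightarrow> Y x ^ Suc n * exp (s * Y x)"
      proof (rule AE_I2)
        fix x
        have "((\<lambda>s. Y x ^ n * exp (s * Y x)) has_real_derivative Y x ^ Suc n * exp (s * Y x)) (at s)"
          by (auto intro!: derivative_eq_intros)
        then have "((\<lambda>h. ?q h x) \<longlongrightarrow> Y x ^ Suc n * exp (s * Y x)) (at 0)"
          by (simp add: DERIV_def)
        then show "(\<lambda>i. ?q (X (i + N)) x) \<longlonglongrightarrow> Y x ^ Suc n * exp (s * Y x)"
          using X LIMSEQ_ignore_initial_segment[OF X(2), of N]
          unfolding tendsto_at_iff_sequentially by (auto simp: o_def)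
      qed
      show "AE x in M. norm (?q (X (i + N)) x) \<le>
          \<bar>Y x\<bar> ^ Suc n * exp ((s + \<delta>) * Y x) + \<bar>Y x\<bar> ^ Suc n * exp ((s - \<delta>) * Y x)" for i
      proof (rule AE_I2)
        fix x
        define h where "h = X (i + N)"
        have h: "h \<noteq> 0" "\<bar>h\<bar> \<le> \<delta>" using X N[of "i + N"] by (auto simp: h_def)
        have "?q h x = Y x ^ n * exp (s * Y x) * (exp (h * Y x) - 1) / h"
          by (simp add: algebra_simps exp_add)
        then have "norm (?q h x) = norm (Y x ^ n * exp (s * Y x) * (exp (h * Y x) - 1) / h)"
          by (simp only:)
        also have "\<dots> = \<bar>Y x\<bar> ^ n * exp (s * Y x) * \<bar>exp (h * Y x) - 1\<bar> / \<bar>h\<bar>"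
          by (simp add: abs_mult power_abs)
        also have "\<dots> \<le> \<bar>Y x\<bar> ^ n * exp (s * Y x) * (\<bar>h * Y x\<bar> * exp \<bar>h * Y x\<bar>) / \<bar>h\<bar>"
          by (intro divide_right_mono mult_left_mono abs_exp_minus_one_le) auto
        also have "\<dots> = \<bar>Y x\<bar> ^ Suc n * exp (s * Y x) * exp \<bar>h * Y x\<bar>"
          using h by (simp add: abs_mult)
        also have "\<dots> \<le> \<bar>Y x\<bar> ^ Suc n * exp (s * Y x) * exp \<bar>\<delta> * Y x\<bar>"
          using h \<delta>(1) by (intro mult_left_mono) (auto simp: abs_mult intro!: mult_right_mono)
        also have "\<dots> \<le> \<bar>Y x\<bar> ^ Suc n * exp (s * Y x) * (exp (\<delta> * Y x) + exp (- (\<delta> * Y x)))"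
          by (intro mult_left_mono exp_abs_le) auto
        also have "\<dots> = \<bar>Y x\<bar> ^ Suc n * exp ((s + \<delta>) * Y x) + \<bar>Y x\<bar> ^ Suc n * exp ((s - \<delta>) * Y x)"
          by (simp add: algebra_simps exp_add exp_diff exp_minus field_simps)
        finally show "norm (?q (X (i + N)) x) \<le>
            \<bar>Y x\<bar> ^ Suc n * exp ((s + \<delta>) * Y x) + \<bar>Y x\<bar> ^ Suc n * exp ((s - \<delta>) * Y x)"
          by (simp add: h_def)
      qed
    qed measurable
    then show "((\<lambda>h. \<integral>x. ?q h x \<partial>M) \<circ> X) \<longlonglongrightarrow> (\<integral>x. Y x ^ Suc n * exp (s * Y x) \<partial>M)"
      unfolding o_def by (rule LIMSEQ_offset)
  qed
  have "eventually (\<lambda>h. (\<integral>x. ?q h x \<partial>M) = ((\<integral>x. Y x ^ n * exp ((s + h) * Y x) \<partial>M)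
      - (\<integral>x. Y x ^ n * exp (s * Y x) \<partial>M)) / h) (at 0)"
    using eventually_at_ball[OF \<delta>(1), of 0 UNIV]
    by eventually_elim
      (subst integral_divide_zero, subst Bochner_Integration.integral_diff, auto intro!: int S' S(2))
  from Lim_transform_eventually[OF lim this] show ?thesis
    by (simp add: DERIV_def)
qed

section \<open>Power and logarithmic moments of the Gamma distribution\<close>

text \<open>Powers are written as \<open>exp (s * ln t)\<close> so that they are exponential moments of \<open>ln\<close> in
  the sense of the previous section.\<close>

lemma has_bochner_integral_gamma_power:
  assumes "\<alpha> > 0" "\<alpha> + s > 0"
  shows "has_bochner_integral (gamma_distribution \<alpha> 1) (\<lambda>t. exp (s * ln t)) (Gamma (\<alpha> + s) / Gamma \<alpha>)"
proof (rule has_bochner_integral_nn_integral)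
  have "(\<integral>\<^sup>+t. ennreal (exp (s * ln t)) \<partial>gamma_distribution \<alpha> 1)
      = (\<integral>\<^sup>+t. ennreal (gamma_density \<alpha> 1 t) * ennreal (exp (s * ln t)) \<partial>lborel)"
    unfolding gamma_distribution_def by (rule nn_integral_density) auto
  also have "\<dots> = (\<integral>\<^sup>+t. ennreal (1 / Gamma \<alpha>) *
      ennreal (indicator {0..} t * t powr (\<alpha> + s - 1) / exp t) \<partial>lborel)"
  proof (rule nn_integral_cong)
    fix t :: real
    show "ennreal (gamma_density \<alpha> 1 t) * ennreal (exp (s * ln t)) =
      ennreal (1 / Gamma \<alpha>) * ennreal (indicator {0..} t * t powr (\<alpha> + s - 1) / exp t)"
    proof (cases "t > 0")
      case True
      have "t powr (\<alpha> - 1) * exp (s * ln t) = t powr (\<alpha> + s - 1)"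
        using True by (simp add: powr_def algebra_simps flip: exp_add)
      with True show ?thesis
        using Gamma_real_pos[OF assms(1)]
        by (simp add: gamma_density_def exp_minus field_simps flip: ennreal_mult)
    qed (auto simp: gamma_density_def indicator_def)
  qed
  also have "\<dots> = ennreal (1 / Gamma \<alpha>) * ennreal (Gamma (\<alpha> + s))"
    using assms Gamma_conv_nn_integral_real[of "\<alpha> + s"] by (subst nn_integral_cmult) auto
  also have "\<dots> = ennreal (Gamma (\<alpha> + s) / Gamma \<alpha>)"
    using assms Gamma_real_pos[of \<alpha>] Gamma_real_pos[of "\<alpha> + s"] by (simp flip: ennreal_mult)
  finally show "(\<integral>\<^sup>+t. ennreal (exp (s * ln t)) \<partial>gamma_distribution \<alpha> 1)
      = ennreal (Gamma (\<alpha> + s) / Gamma \<alpha>)" .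
qed (use assms Gamma_real_pos[of \<alpha>] Gamma_real_pos[of "\<alpha> + s"] in \<open>auto simp: gamma_distribution_def\<close>)

lemma AE_gamma_distribution_pos: "AE t in gamma_distribution \<alpha> \<theta>. t > 0"
  unfolding gamma_distribution_def by (subst AE_density) (auto simp: gamma_density_def)

text \<open>The power moment is differentiated twice in its exponent, once through the integral and once
  through the Gamma function: the first derivative gives the first formula at every \<open>s\<close>, and
  differentiating that formula at \<open>s = 0\<close> gives the second.\<close>

lemma log_gamma_moments:
  fixes \<alpha> s :: real
  assumes "\<alpha> > 0"
  defines "M \<equiv> gamma_distribution \<alpha> 1"
  shows "\<alpha> + s > 0 \<Longrightarrow> has_bochner_integral M (\<lambda>t. ln t * exp (s * ln t))
      (Gamma (\<alpha> + s) * Digamma (\<alpha> + s) / Gamma \<alpha>)"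
    and "has_bochner_integral M (\<lambda>t. (ln t)\<^sup>2) ((Digamma \<alpha>)\<^sup>2 + deriv Digamma \<alpha>)"
proof -
  have [measurable]: "ln \<in> borel_measurable M" by (simp add: M_def gamma_distribution_def)
  let ?S = "{- \<alpha><..}"
  have mgf: "integrable M (\<lambda>t. exp (s * ln t))" and F0: "(\<integral>t. exp (s * ln t) \<partial>M) = Gamma (\<alpha> + s) / Gamma \<alpha>"
    if "s \<in> ?S" for s
    using has_bochner_integral_gamma_power[of \<alpha> s] assms(1) that
    by (auto simp: has_bochner_integral_iff M_def)
  have int: "integrable M (\<lambda>t. ln t ^ n * exp (s * ln t))" if "s \<in> ?S" for n s
    using integrable_power_exp[of ln M ?S s n] mgf that
    by (auto elim!: Bochner_Integration.integrable_bound simp: abs_mult power_abs)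
  have D: "((\<lambda>s. \<integral>t. ln t ^ n * exp (s * ln t) \<partial>M) has_real_derivative
      (\<integral>t. ln t ^ Suc n * exp (s * ln t) \<partial>M)) (at s)" if "s \<in> ?S" for n s
    by (rule has_real_derivative_integral_power_exp[OF _ mgf _ that]) auto
  have F0': "((\<lambda>s. Gamma (\<alpha> + s) / Gamma \<alpha>) has_real_derivative
      Gamma (\<alpha> + s) * Digamma (\<alpha> + s) / Gamma \<alpha>) (at s)" if "s \<in> ?S" for s
  proof -
    have "\<alpha> + s \<notin> \<int>\<^sub>\<le>\<^sub>0" using that by (auto elim!: nonpos_Ints_cases)
    then show ?thesis
      using Gamma_real_pos[OF assms(1)] by (auto intro!: derivative_eq_intros)
  qed
  have F1: "(\<integral>t. ln t * exp (s * ln t) \<partial>M) = Gamma (\<alpha> + s) * Digamma (\<alpha> + s) / Gamma \<alpha>"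
    if s: "s \<in> ?S" for s
  proof (rule DERIV_unique)
    show "((\<lambda>s. \<integral>t. exp (s * ln t) \<partial>M) has_real_derivative (\<integral>t. ln t * exp (s * ln t) \<partial>M)) (at s)"
      using D[of s 0] s by simp
    show "((\<lambda>s. \<integral>t. exp (s * ln t) \<partial>M) has_real_derivative
        Gamma (\<alpha> + s) * Digamma (\<alpha> + s) / Gamma \<alpha>) (at s)"
      by (rule has_field_derivative_transform_within_open[OF F0'[OF s], of ?S]) (use s F0 in auto)
  qed
  show "has_bochner_integral M (\<lambda>t. ln t * exp (s * ln t))
      (Gamma (\<alpha> + s) * Digamma (\<alpha> + s) / Gamma \<alpha>)" if "\<alpha> + s > 0"
    using F1[of s] int[of s 1] that by (simp add: has_bochner_integral_iff)
  have 0: "0 \<in> ?S" using assms(1) by simp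
  have "\<alpha> \<notin> \<int>\<^sub>\<le>\<^sub>0" using assms(1) by (auto elim!: nonpos_Ints_cases)
  then have dig: "(Digamma has_real_derivative deriv Digamma \<alpha>) (at \<alpha>)"
    by (metis DERIV_imp_deriv has_field_derivative_Polygamma)
  have "((\<lambda>s. Digamma (\<alpha> + s)) has_real_derivative deriv Digamma \<alpha>) (at 0)"
    by (rule DERIV_chain'[where f = "\<lambda>s. \<alpha> + s" and g = Digamma, THEN DERIV_cong])
       (use dig in \<open>auto intro!: derivative_eq_intros\<close>)
  from DERIV_mult[OF F0'[OF 0] this]
  have der: "((\<lambda>s. Gamma (\<alpha> + s) / Gamma \<alpha> * Digamma (\<alpha> + s)) has_real_derivative
      (Digamma \<alpha>)\<^sup>2 + deriv Digamma \<alpha>) (at 0)"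
    using Gamma_real_pos[OF assms(1)] by (simp add: power2_eq_square field_simps)
  have "(\<integral>t. (ln t)\<^sup>2 \<partial>M) = (Digamma \<alpha>)\<^sup>2 + deriv Digamma \<alpha>"
  proof (rule DERIV_unique)
    show "((\<lambda>s. \<integral>t. ln t * exp (s * ln t) \<partial>M) has_real_derivative (\<integral>t. (ln t)\<^sup>2 \<partial>M)) (at 0)"
      using D[of 0 1] 0 by (simp add: power2_eq_square)
    show "((\<lambda>s. \<integral>t. ln t * exp (s * ln t) \<partial>M) has_real_derivative
        (Digamma \<alpha>)\<^sup>2 + deriv Digamma \<alpha>) (at 0)"
      by (rule has_field_derivative_transform_within_open[OF der, of ?S]) (use 0 F1 in auto)
  qed
  then show "has_bochner_integral M (\<lambda>t. (ln t)\<^sup>2) ((Digamma \<alpha>)\<^sup>2 + deriv Digamma \<alpha>)"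
    using int[OF 0, of 2] by (simp add: has_bochner_integral_iff)
qed

text \<open>The condition \<open>\<alpha> > 2 * m\<close> is what makes the square of \<open>t powr (- m)\<close> integrable.
  It also covers the first power: averaged with \<open>\<alpha> > 0\<close> it gives \<open>\<alpha> > m\<close>.\<close>

lemma first_stage_loss_moments:
  fixes \<alpha> m k :: real
  assumes "\<alpha> > 0" "m \<noteq> 0" "\<alpha> > 2 * m"
    and k: "k = (Gamma \<alpha> / Gamma (\<alpha> - m)) powr (1 / m)"
  defines "M \<equiv> gamma_distribution \<alpha> 1" and "g \<equiv> \<lambda>t. rho m (k / t)"
  shows "integrable M (\<lambda>t. (g t)\<^sup>2)"
    and "(\<integral>t. g t \<partial>M) = m * Digamma \<alpha> + ln (Gamma (\<alpha> - m) / Gamma \<alpha>)"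
    and "prob_space.variance M g =
      k powr (2 * m) * (Gamma (\<alpha> - 2 * m) / Gamma \<alpha> - (Gamma (\<alpha> - m) / Gamma \<alpha>)\<^sup>2)
          + m\<^sup>2 * deriv Digamma \<alpha>
          + 2 * m * k powr m * (Gamma (\<alpha> - m) / Gamma \<alpha>) * (Digamma (\<alpha> - m) - Digamma \<alpha>)"
proof -
  interpret prob_space M unfolding M_def using assms by (intro prob_space_gamma_distribution) auto
  have \<alpha>m: "\<alpha> - m > 0" using assms by simp
  have Gpos: "Gamma \<alpha> > 0" "Gamma (\<alpha> - m) > 0" using assms \<alpha>m by (auto intro: Gamma_real_pos)
  have kpos: "k > 0" using Gpos by (simp add: k)
  have km: "k powr m = Gamma \<alpha> / Gamma (\<alpha> - m)" using Gpos assms(2) by (simp add: k powr_powr)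
  have lnk: "m * ln k = - ln (Gamma (\<alpha> - m) / Gamma \<alpha>)"
    using Gpos assms(2) by (simp add: k ln_powr ln_div)
  define U where "U t = exp (- m * ln t)" for t :: real
  define c where "c = k powr m"
  define e where "e = m * ln k + 1"
  define A where "A = Gamma (\<alpha> - m) / Gamma \<alpha>"
  define A2 where "A2 = Gamma (\<alpha> - 2 * m) / Gamma \<alpha>"
  define h where "h t = c * U t + m * ln t - e" for t
  have U2: "(exp (- (m * ln t)))\<^sup>2 = exp (- (2 * m * ln t))" for t
    by (simp add: power2_eq_square flip: exp_add)
  have mom: "integrable M U" "(\<integral>t. U t \<partial>M) = A"
      "integrable M (\<lambda>t. (U t)\<^sup>2)" "(\<integral>t. (U t)\<^sup>2 \<partial>M) = A2"
      "integrable M ln" "(\<integral>t. ln t \<partial>M) = Digamma \<alpha>"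
      "integrable M (\<lambda>t. ln t * U t)" "(\<integral>t. ln t * U t \<partial>M) = A * Digamma (\<alpha> - m)"
      "integrable M (\<lambda>t. (ln t)\<^sup>2)" "(\<integral>t. (ln t)\<^sup>2 \<partial>M) = (Digamma \<alpha>)\<^sup>2 + deriv Digamma \<alpha>"
    using has_bochner_integral_gamma_power[of \<alpha> "- m"] has_bochner_integral_gamma_power[of \<alpha> "- (2 * m)"]
      log_gamma_moments(1)[of \<alpha> 0] log_gamma_moments(1)[of \<alpha> "- m"]
      log_gamma_moments(2)[of \<alpha>] assms(1,3) \<alpha>m Gpos
    by (auto simp: has_bochner_integral_iff U2 A_def A2_def M_def U_def[abs_def])
  \<comment> \<open>The normalization for which \<open>k\<close> is chosen: the power term of the loss has mean 1,
    cancelling the constant \<open>- 1\<close> of \<open>rho\<close>.\<close>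
  have cA: "c * A = 1" using Gpos by (simp add: c_def A_def km)
  have gh: "AE t in M. g t = h t"
    unfolding M_def using AE_gamma_distribution_pos
  proof eventually_elim
    case (elim t)
    have "(k / t) powr m = c * U t"
      using elim kpos by (simp add: c_def U_def powr_def ln_div right_diff_distrib flip: exp_add)
    then show ?case
      using elim kpos by (simp add: g_def rho_def h_def e_def ln_div algebra_simps)
  qed
  have [measurable]: "g \<in> borel_measurable M" "h \<in> borel_measurable M"
    unfolding g_def rho_def h_def U_def M_def gamma_distribution_def by measurable
  have h2: "(h t - a)\<^sup>2 = c\<^sup>2 * (U t)\<^sup>2 + m\<^sup>2 * (ln t)\<^sup>2 + 2 * c * m * (ln t * U t)
      - 2 * (e + a) * c * U t - 2 * (e + a) * m * ln t + (e + a)\<^sup>2" for t a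
    by (simp add: h_def power2_eq_square algebra_simps)
  have int_h2: "integrable M (\<lambda>t. (h t - a)\<^sup>2)" for a
    unfolding h2 using mom by auto
  have "integrable M (\<lambda>t. (h t)\<^sup>2)" using int_h2[of 0] by simp
  then show "integrable M (\<lambda>t. (g t)\<^sup>2)"
    by (rule integrable_cong_AE_imp) (use gh in \<open>auto elim!: eventually_mono\<close>)
  have Eg: "expectation g = expectation h"
    by (intro integral_cong_AE gh) auto
  also have Eh: "expectation h = c * A + m * Digamma \<alpha> - e"
    unfolding h_def using mom by (simp add: prob_space)
  finally have E: "expectation g = c * A + m * Digamma \<alpha> - e" .
  then show "expectation g = m * Digamma \<alpha> + ln (Gamma (\<alpha> - m) / Gamma \<alpha>)"
    unfolding cA e_def using lnk by simp
  have "variance g = (\<integral>t. (h t - expectation g)\<^sup>2 \<partial>M)"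
    by (intro integral_cong_AE) (use gh in \<open>auto elim!: eventually_mono\<close>)
  also have "\<dots> = c\<^sup>2 * A2 + m\<^sup>2 * ((Digamma \<alpha>)\<^sup>2 + deriv Digamma \<alpha>) + 2 * c * m * (A * Digamma (\<alpha> - m))
      - 2 * (e + expectation g) * c * A - 2 * (e + expectation g) * m * Digamma \<alpha> + (e + expectation g)\<^sup>2"
    unfolding h2 using mom by (simp add: prob_space)
  also have "\<dots> = c\<^sup>2 * (A2 - A\<^sup>2) + m\<^sup>2 * deriv Digamma \<alpha> + 2 * m * c * A * (Digamma (\<alpha> - m) - Digamma \<alpha>)"
    unfolding E by (simp add: power2_eq_square algebra_simps)
  also have "c\<^sup>2 = k powr (2 * m)"
    using kpos by (simp add: c_def power2_eq_square flip: powr_add)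
  finally show "variance g = k powr (2 * m) * (Gamma (\<alpha> - 2 * m) / Gamma \<alpha> - (Gamma (\<alpha> - m) / Gamma \<alpha>)\<^sup>2)
          + m\<^sup>2 * deriv Digamma \<alpha>
          + 2 * m * k powr m * (Gamma (\<alpha> - m) / Gamma \<alpha>) * (Digamma (\<alpha> - m) - Digamma \<alpha>)"
    by (simp only: A_def A2_def c_def)
qed

section \<open>Risk and posterior loss in scale families\<close>

lemma nn_integral_square_loss:
  fixes g :: "'a \<Rightarrow> real"
  assumes "prob_space M" and [measurable]: "g \<in> borel_measurable M"
    and sq: "integrable M (\<lambda>x. (g x)\<^sup>2)"
  shows "(\<integral>\<^sup>+x. ennreal ((a - g x)\<^sup>2) \<partial>M)
    = ennreal (prob_space.variance M g + (a - prob_space.expectation M g)\<^sup>2)"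
proof -
  interpret prob_space M by fact
  have g: "integrable M g" using sq by (rule square_integrable_imp_integrable[rotated]) auto
  have eq: "(a - g x)\<^sup>2 = (g x)\<^sup>2 - 2 * a * g x + a\<^sup>2" for x
    by (simp add: power2_eq_square algebra_simps)
  have "(\<integral>\<^sup>+x. ennreal ((a - g x)\<^sup>2) \<partial>M) = ennreal (\<integral>x. (a - g x)\<^sup>2 \<partial>M)"
    using g sq by (intro nn_integral_eq_integral) (simp_all add: eq, simp flip: eq)
  also have "(\<integral>x. (a - g x)\<^sup>2 \<partial>M) = variance g + (a - expectation g)\<^sup>2"
    unfolding variance_eq[OF g sq] eq using g sq
    by (simp add: prob_space power2_eq_square algebra_simps)
  finally show ?thesis .
qed

lemma gamma_density_scale:
  assumes "\<theta> > 0"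
  shows "gamma_density \<alpha> \<theta> x = \<theta> * gamma_density \<alpha> 1 (\<theta> * x)"
proof (cases "x > 0")
  case True
  have "\<theta> * (\<theta> powr (\<alpha> - 1)) = \<theta> powr \<alpha>"
    using assms by (simp add: powr_diff)
  with True assms show ?thesis
    by (simp add: gamma_density_def powr_mult)
qed (use assms in \<open>auto simp: gamma_density_def zero_less_mult_iff\<close>)

lemma scale_family_risk:
  fixes f g d :: "real \<Rightarrow> real"
  assumes [measurable]: "f \<in> borel_measurable borel" "g \<in> borel_measurable borel" "d \<in> borel_measurable borel"
    and f: "\<And>t. f t \<ge> 0" and P: "P \<theta> = density lborel (\<lambda>x. ennreal (\<theta> * f (\<theta> * x)))"
    and L: "\<And>x. L \<theta> x = g (\<theta> * x)" and "\<theta> > 0"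
  shows "risk P L \<theta> d = (\<integral>\<^sup>+x. ennreal ((d x - g (\<theta> * x))\<^sup>2 * (\<theta> * f (\<theta> * x))) \<partial>lborel)"
proof -
  have "risk P L \<theta> d = (\<integral>\<^sup>+x. ennreal (\<theta> * f (\<theta> * x)) * ennreal ((d x - g (\<theta> * x))\<^sup>2) \<partial>lborel)"
    unfolding risk_def P L by (rule nn_integral_density) measurable
  also have "\<dots> = (\<integral>\<^sup>+x. ennreal ((d x - g (\<theta> * x))\<^sup>2 * (\<theta> * f (\<theta> * x))) \<partial>lborel)"
    using f \<open>\<theta> > 0\<close> by (intro nn_integral_cong) (simp add: mult.commute flip: ennreal_mult)
  finally show ?thesis .
qed

text \<open>The substitution \<open>t = \<theta> * x\<close> turns the law of the observation into that of the pivot, and the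
  parameter disappears.\<close>

lemma scale_family_risk_const:
  fixes f g :: "real \<Rightarrow> real"
  assumes [measurable]: "f \<in> borel_measurable borel" "g \<in> borel_measurable borel"
    and f: "\<And>t. f t \<ge> 0" and P: "P \<theta> = density lborel (\<lambda>x. ennreal (\<theta> * f (\<theta> * x)))"
    and L: "\<And>x. L \<theta> x = g (\<theta> * x)" and "\<theta> > 0"
  shows "risk P L \<theta> (\<lambda>_. c) = (\<integral>\<^sup>+t. ennreal ((c - g t)\<^sup>2) \<partial>density lborel f)"
proof -
  have "(\<integral>\<^sup>+t. ennreal ((c - g t)\<^sup>2) \<partial>density lborel f)
      = (\<integral>\<^sup>+t. ennreal (f t) * ennreal ((c - g t)\<^sup>2) \<partial>lborel)"
    by (rule nn_integral_density) measurable
  also have "\<dots> = ennreal \<bar>\<theta>\<bar> * (\<integral>\<^sup>+x. ennreal (f (\<theta> * x)) * ennreal ((c - g (\<theta> * x))\<^sup>2) \<partial>lborel)"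
    using \<open>\<theta> > 0\<close> by (subst nn_integral_real_affine[where c = \<theta> and t = 0]) auto
  also have "\<dots> = (\<integral>\<^sup>+x. ennreal \<bar>\<theta>\<bar> * (ennreal (f (\<theta> * x)) * ennreal ((c - g (\<theta> * x))\<^sup>2)) \<partial>lborel)"
    by (rule nn_integral_cmult [symmetric]) measurable
  also have "\<dots> = risk P L \<theta> (\<lambda>_. c)"
    using f \<open>\<theta> > 0\<close>
    by (subst scale_family_risk[where L = L and P = P and f = f and g = g])
       (auto intro!: nn_integral_cong simp: P L ac_simps simp flip: ennreal_mult)
  finally show ?thesis by simp
qed

text \<open>The prior \<open>1 / \<theta>\<close> cancels the Jacobian factor \<open>\<theta>\<close> of the likelihood, leaving
  \<open>f (\<theta> * x)\<close> as the unnormalized posterior density.\<close>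

lemma marginal_scale_family:
  fixes f :: "real \<Rightarrow> real"
  assumes [measurable]: "f \<in> borel_measurable borel"
    and f0: "\<And>t. t \<le> 0 \<Longrightarrow> f t = 0"
    and prob: "prob_space (density lborel f)"
    and lik: "\<And>\<theta>. \<theta> > 0 \<Longrightarrow> lik \<theta> x = \<theta> * f (\<theta> * x)" and x: "x > 0"
  shows "marginal (\<lambda>\<theta>. 1 / \<theta>) lik {0<..} x = ennreal (1 / x)"
proof -
  have w: "ennreal (1 / \<theta> * lik \<theta> x) * indicator {0<..} \<theta> = ennreal (f (x * \<theta>))" for \<theta>
    using lik[of \<theta>] f0[of "x * \<theta>"] x
    by (cases "\<theta> > 0") (auto simp: mult.commute[of \<theta>] mult_nonneg_nonpos)
  have "emeasure (density lborel f) (space (density lborel f)) = 1"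
    using prob by (rule prob_space.emeasure_space_1)
  then have one: "(\<integral>\<^sup>+t. ennreal (f t) \<partial>lborel) = 1"
    by (simp add: emeasure_density)
  have "(\<integral>\<^sup>+\<theta>. ennreal (f (x * \<theta>)) \<partial>lborel) = ennreal (1 / x) * (\<integral>\<^sup>+t. ennreal (f t) \<partial>lborel)"
    using x nn_integral_real_affine[of "\<lambda>\<theta>. ennreal (f (x * \<theta>))" "1 / x" 0] by simp
  then show ?thesis
    unfolding marginal_def w one by simp
qed

text \<open>The posterior law of \<open>\<theta> * x\<close> is the law of the pivot: this is where the prior has to be the
  Haar measure.\<close>

lemma posterior_loss_scale_family:
  fixes f g :: "real \<Rightarrow> real"
  assumes [measurable]: "f \<in> borel_measurable borel" "g \<in> borel_measurable borel"
    and f0: "\<And>t. t \<le> 0 \<Longrightarrow> f t = 0"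
    and prob: "prob_space (density lborel f)"
    and lik: "\<And>\<theta>. \<theta> > 0 \<Longrightarrow> lik \<theta> x = \<theta> * f (\<theta> * x)"
    and L: "\<And>\<theta>. \<theta> > 0 \<Longrightarrow> L \<theta> x = g (\<theta> * x)" and x: "x > 0"
  shows "posterior_loss (\<lambda>\<theta>. 1 / \<theta>) lik {0<..} L x a
      = (\<integral>\<^sup>+t. ennreal ((a - g t)\<^sup>2) \<partial>density lborel f)"
proof -
  have marg: "marginal (\<lambda>\<theta>. 1 / \<theta>) lik {0<..} x = ennreal (1 / x)"
    by (rule marginal_scale_family[of f]) (use assms in auto)
  have w: "ennreal (1 / \<theta> * lik \<theta> x) * indicator {0<..} \<theta> = ennreal (f (x * \<theta>))" for \<theta>
    using lik[of \<theta>] f0[of "x * \<theta>"] x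
    by (cases "\<theta> > 0") (auto simp: mult.commute[of \<theta>] mult_nonneg_nonpos)
  have xx: "ennreal (1 / x) * (c / ennreal (1 / x)) = c" for c
    using x by (simp add: ennreal_times_divide ennreal_mult_divide_eq mult.commute)
  have "posterior_loss (\<lambda>\<theta>. 1 / \<theta>) lik {0<..} L x a = (\<integral>\<^sup>+\<theta>. ennreal ((a - g (x * \<theta>))\<^sup>2)
      \<partial>density lborel (\<lambda>\<theta>. ennreal (f (x * \<theta>)) / ennreal (1 / x)))"
    unfolding posterior_loss_def posterior_def marg w
  proof (intro nn_integral_cong_AE)
    have pos: "\<theta> > 0" if "0 < ennreal (f (x * \<theta>)) / ennreal (1 / x)" for \<theta>
      using f0[of "x * \<theta>"] that x by (cases "\<theta> > 0") (auto simp: mult_nonneg_nonpos)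
    have "(\<lambda>\<theta>. ennreal (f (x * \<theta>)) / ennreal (1 / x)) \<in> borel_measurable lborel"
      by measurable
    then show "AE \<theta> in density lborel (\<lambda>\<theta>. ennreal (f (x * \<theta>)) / ennreal (1 / x)).
        ennreal ((a - L \<theta> x)\<^sup>2) = ennreal ((a - g (x * \<theta>))\<^sup>2)"
      by (simp only: AE_density) (intro AE_I2 impI, simp only: L pos mult.commute[of x])
  qed
  also have "\<dots> = (\<integral>\<^sup>+\<theta>. ennreal (f (x * \<theta>)) / ennreal (1 / x) * ennreal ((a - g (x * \<theta>))\<^sup>2) \<partial>lborel)"
    by (rule nn_integral_density) measurable
  also have "\<dots> = ennreal (1 / x) * (\<integral>\<^sup>+t. ennreal (f t) / ennreal (1 / x) * ennreal ((a - g t)\<^sup>2) \<partial>lborel)"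
    using x
    by (subst nn_integral_real_affine[where c = "1 / x" and t = 0]) auto
  also have "\<dots> = (\<integral>\<^sup>+t. ennreal (1 / x) * (ennreal (f t) / ennreal (1 / x) * ennreal ((a - g t)\<^sup>2)) \<partial>lborel)"
    by (rule nn_integral_cmult [symmetric]) measurable
  also have "\<dots> = (\<integral>\<^sup>+t. ennreal (f t) * ennreal ((a - g t)\<^sup>2) \<partial>lborel)"
    by (simp add: xx flip: mult.assoc)
  also have "\<dots> = (\<integral>\<^sup>+t. ennreal ((a - g t)\<^sup>2) \<partial>density lborel f)"
    by (rule nn_integral_density [symmetric]) measurable
  finally show ?thesis .
qed

section \<open>The minimax lower bound\<close>

text \<open>Expanding the square, the least value over \<open>a\<close> of the loss truncated to \<open>A n\<close> is
  \<open>r - q\<^sup>2 / p\<close>, where \<open>p\<close>, \<open>q\<close>, \<open>r\<close> are the truncated moments of \<open>g\<close> of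
  order 0, 1 and 2. These converge to the full moments, for which \<open>r - q\<^sup>2 / p\<close> is the
  variance. The point is that one \<open>n\<close> serves all \<open>a\<close>.\<close>

lemma truncated_square_loss_approximates_variance:
  fixes g :: "'a \<Rightarrow> real"
  assumes "prob_space M" and [measurable]: "g \<in> borel_measurable M" "\<And>n. A n \<in> sets M"
    and sq: "integrable M (\<lambda>x. (g x)\<^sup>2)"
    and "incseq A" and AE: "AE x in M. x \<in> (\<Union>n. A n)"
    and v: "v < prob_space.variance M g"
  shows "\<exists>n::nat. \<forall>a. ennreal v \<le> (\<integral>\<^sup>+x. ennreal ((a - g x)\<^sup>2) * indicator (A n) x \<partial>M)"
proof -
  interpret prob_space M by fact
  have g: "integrable M g" using sq by (rule square_integrable_imp_integrable[rotated]) auto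
  have lim: "(\<lambda>n. \<integral>x. indicator (A n) x * f x \<partial>M) \<longlonglongrightarrow> (\<integral>x. f x \<partial>M)"
    if f: "integrable M f" for f :: "'a \<Rightarrow> real"
  proof -
    note [measurable] = borel_measurable_integrable[OF f]
    have "(\<lambda>n. LINT x:A n|M. f x) \<longlonglongrightarrow> (LINT x:(\<Union>n. A n)|M. f x)"
      using f by (intro set_integral_cont_up \<open>incseq A\<close>) (auto simp: set_integrable_def simp del: real_scaleR_def intro!: integrable_mult_indicator)
    also have "(LINT x:(\<Union>n. A n)|M. f x) = (\<integral>x. f x \<partial>M)"
      unfolding set_lebesgue_integral_def
      by (intro integral_cong_AE) (use AE in \<open>auto simp: indicator_def elim!: eventually_mono\<close>)
    finally show ?thesis by (simp add: set_lebesgue_integral_def)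
  qed
  define p q r where "p n = (\<integral>x. indicator (A n) x * (1 :: real) \<partial>M)"
    and "q n = (\<integral>x. indicator (A n) x * g x \<partial>M)"
    and "r n = (\<integral>x. indicator (A n) x * (g x)\<^sup>2 \<partial>M)" for n
  have p: "p \<longlonglongrightarrow> 1" and q: "q \<longlonglongrightarrow> expectation g" and r: "r \<longlonglongrightarrow> expectation (\<lambda>x. (g x)\<^sup>2)"
    unfolding p_def q_def r_def using lim[of "\<lambda>_. 1"] lim[OF g] lim[OF sq] by (auto simp: prob_space)
  have "(\<lambda>n. r n - (q n)\<^sup>2 / p n) \<longlonglongrightarrow> expectation (\<lambda>x. (g x)\<^sup>2) - (expectation g)\<^sup>2 / 1"
    by (intro tendsto_intros p q r) auto
  then have "(\<lambda>n. r n - (q n)\<^sup>2 / p n) \<longlonglongrightarrow> variance g"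
    using g sq by (simp add: variance_eq)
  then have "eventually (\<lambda>n. r n - (q n)\<^sup>2 / p n > v) sequentially"
    using v by (auto dest: order_tendstoD)
  moreover have "eventually (\<lambda>n. p n > 0) sequentially"
    using p by (rule order_tendstoD) auto
  ultimately have "eventually (\<lambda>n. r n - (q n)\<^sup>2 / p n > v \<and> p n > 0) sequentially"
    by eventually_elim auto
  then obtain n where n: "r n - (q n)\<^sup>2 / p n > v" "p n > 0"
    by (auto simp: eventually_sequentially)
  have "ennreal v \<le> (\<integral>\<^sup>+x. ennreal ((a - g x)\<^sup>2) * indicator (A n) x \<partial>M)" for a
  proof -
    have int: "integrable M (\<lambda>x. indicator (A n) x * f x)" if "integrable M f" for f :: "'a \<Rightarrow> real"
      using integrable_mult_indicator[OF _ that, of "A n"] by simp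
    \<comment> \<open>The quadratic in \<open>a\<close> is minimal at \<open>a = q n / p n\<close>.\<close>
    have "r n - (q n)\<^sup>2 / p n \<le> r n - 2 * a * q n + a\<^sup>2 * p n"
    proof -
      have "0 \<le> (a * p n - q n)\<^sup>2 / p n" using n(2) by simp
      also have "\<dots> = a\<^sup>2 * p n - 2 * a * q n + (q n)\<^sup>2 / p n"
        using n(2) by (simp add: power2_eq_square field_simps)
      finally show ?thesis by simp
    qed
    also have "\<dots> = (\<integral>x. indicator (A n) x * (g x)\<^sup>2 - 2 * a * (indicator (A n) x * g x) + a\<^sup>2 * (indicator (A n) x * 1) \<partial>M)"
      unfolding p_def q_def r_def using int[OF g] int[OF sq] int[of "\<lambda>_. 1"] by simp
    also have "\<dots> = (\<integral>x. (a - g x)\<^sup>2 * indicator (A n) x \<partial>M)"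
      by (rule arg_cong[where f = "integral\<^sup>L M"]) (auto simp: fun_eq_iff power2_eq_square algebra_simps)
    finally have le: "v \<le> (\<integral>x. (a - g x)\<^sup>2 * indicator (A n) x \<partial>M)" using n(1) by simp
    have "integrable M (\<lambda>x. indicator (A n) x * ((g x)\<^sup>2 - 2 * a * g x + a\<^sup>2))"
      using g sq by (intro int) auto
    then have "integrable M (\<lambda>x. (a - g x)\<^sup>2 * indicator (A n) x)"
      by (rule back_subst[of "integrable M"]) (auto simp: fun_eq_iff power2_eq_square algebra_simps)
    then have "(\<integral>\<^sup>+x. ennreal ((a - g x)\<^sup>2 * indicator (A n) x) \<partial>M)
        = ennreal (\<integral>x. (a - g x)\<^sup>2 * indicator (A n) x \<partial>M)"
      by (intro nn_integral_eq_integral) auto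
    then show ?thesis using le by (auto simp: ennreal_mult ennreal_indicator intro: ennreal_leI)
  qed
  then show ?thesis by blast
qed

text \<open>This is the mass of the window of scale parameters under the prior, that is, under Haar measure.\<close>

lemma nn_integral_inverse_exp_interval:
  assumes "r \<ge> 0"
  shows "(\<integral>\<^sup>+x. ennreal (1 / x) * indicator {exp (- r)..exp r} x \<partial>lborel) = ennreal (2 * r)"
proof -
  have "(\<integral>\<^sup>+x. ennreal (1 / x) * indicator {exp (- r)..exp r} x \<partial>lborel) = ln (exp r) - ln (exp (- r))"
  proof (rule nn_integral_FTC_Icc)
    show "(ln has_real_derivative 1 / x) (at x)" if "x \<in> {exp (- r)..exp r}" for x
    proof -
      have "0 < exp (- r)" by simp
      also have "\<dots> \<le> x" using that by simp
      finally show ?thesis by (auto intro!: derivative_eq_intros)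
    qed
    show "0 \<le> 1 / x" if "x \<in> {exp (- r)..exp r}" for x
      using that order_trans[of 0 "exp (- r)" x] by simp
  qed (use assms in auto)
  then show ?thesis by simp
qed

text \<open>A uniform bound on the truncated loss over all constants \<open>a\<close> is a bound for each value
  \<open>d x\<close>, so it survives averaging the risk over the scale parameter. With the parameter in the
  window \<open>[exp (-N), exp N]\<close> this yields \<open>v * (N - K) \<le> R * N\<close> for all \<open>N \<ge> K\<close>; the
  loss of \<open>K\<close> at the ends of the window is negligible for large \<open>N\<close>.\<close>

lemma scale_family_average_risk_bound:
  fixes f g d :: "real \<Rightarrow> real"
  assumes [measurable]: "f \<in> borel_measurable borel" "g \<in> borel_measurable borel" "d \<in> borel_measurable borel"
    and f: "\<And>t. f t \<ge> 0" and "K \<ge> 0" "v \<ge> 0" "R \<ge> 0"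
    and v: "\<And>a. ennreal v \<le> (\<integral>\<^sup>+t. ennreal ((a - g t)\<^sup>2 * f t) * indicator {exp (- K)..exp K} t \<partial>lborel)"
    and R: "\<And>\<theta>. \<theta> > 0 \<Longrightarrow> (\<integral>\<^sup>+x. ennreal ((d x - g (\<theta> * x))\<^sup>2 * (\<theta> * f (\<theta> * x))) \<partial>lborel) \<le> ennreal R"
  shows "v \<le> R"
proof -
  have main: "v * (N - K) \<le> R * N" if N: "N \<ge> K" for N
  proof -
    let ?I = "\<lambda>r. {exp (- r)..exp r :: real}"
    have I_pos: "x > 0" if "x \<in> ?I r" for x r
      using that less_le_trans[of 0 "exp (- r)" x] by simp
    let ?J = "\<lambda>x t. ennreal ((d x - g t)\<^sup>2 * f t)"
    have "ennreal v * ennreal (2 * (N - K))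
        = (\<integral>\<^sup>+x. ennreal v * (ennreal (1 / x) * indicator (?I (N - K)) x) \<partial>lborel)"
      using nn_integral_inverse_exp_interval[of "N - K"] N
      by (subst nn_integral_cmult) auto
    also have "\<dots> \<le> (\<integral>\<^sup>+x. (\<integral>\<^sup>+\<theta>. ?J x (\<theta> * x) * indicator (?I N) \<theta> \<partial>lborel) \<partial>lborel)"
    proof (intro nn_integral_mono)
      fix x :: real
      show "ennreal v * (ennreal (1 / x) * indicator (?I (N - K)) x)
          \<le> (\<integral>\<^sup>+\<theta>. ?J x (\<theta> * x) * indicator (?I N) \<theta> \<partial>lborel)"
      proof (cases "x \<in> ?I (N - K)")
        case True
        then have x: "x > 0" by (rule I_pos)
        have sub: "t / x \<in> ?I N" if t: "t \<in> ?I K" for t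
        proof -
          have "exp (- N) * x \<le> exp (- N) * exp (N - K)" using True by (intro mult_left_mono) auto
          also have "\<dots> = exp (- K)" by (simp flip: exp_add)
          finally have 1: "exp (- N) * x \<le> t" using t by simp
          have "t \<le> exp K" using t by simp
          also have "\<dots> = exp N * exp (- (N - K))" by (simp flip: exp_add)
          also have "\<dots> \<le> exp N * x" using True by (intro mult_left_mono) auto
          finally show ?thesis using 1 x by (simp add: field_simps)
        qed
        have "ennreal v * ennreal (1 / x)
            \<le> ennreal (1 / x) * (\<integral>\<^sup>+t. ?J x t * indicator (?I K) t \<partial>lborel)"
          unfolding mult.commute[of "ennreal v"] by (rule mult_left_mono[OF v]) simp
        also have "\<dots> \<le> ennreal (1 / x) * (\<integral>\<^sup>+t. ?J x t * indicator (?I N) (t / x) \<partial>lborel)"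
          using sub by (intro mult_left_mono nn_integral_mono) (auto simp: indicator_def)
        also have "\<dots> = (\<integral>\<^sup>+\<theta>. ?J x (\<theta> * x) * indicator (?I N) \<theta> \<partial>lborel)"
          using x by (subst (2) nn_integral_real_affine[where c = "1 / x" and t = 0]) auto
        finally show ?thesis using True by simp
      qed simp
    qed
    also have "\<dots> = (\<integral>\<^sup>+\<theta>. (\<integral>\<^sup>+x. ?J x (\<theta> * x) * indicator (?I N) \<theta> \<partial>lborel) \<partial>lborel)"
      by (rule lborel_pair.Fubini') measurable
    also have "\<dots> \<le> (\<integral>\<^sup>+\<theta>. ennreal R * (ennreal (1 / \<theta>) * indicator (?I N) \<theta>) \<partial>lborel)"
    proof (intro nn_integral_mono)
      fix \<theta> :: real
      show "(\<integral>\<^sup>+x. ?J x (\<theta> * x) * indicator (?I N) \<theta> \<partial>lborel)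
          \<le> ennreal R * (ennreal (1 / \<theta>) * indicator (?I N) \<theta>)"
      proof (cases "\<theta> \<in> ?I N")
        case True
        then have \<theta>: "\<theta> > 0" by (rule I_pos)
        have "(\<integral>\<^sup>+x. ?J x (\<theta> * x) * indicator (?I N) \<theta> \<partial>lborel)
            = (\<integral>\<^sup>+x. ennreal (1 / \<theta>) * ennreal ((d x - g (\<theta> * x))\<^sup>2 * (\<theta> * f (\<theta> * x))) \<partial>lborel)"
          using True \<theta> f by (intro nn_integral_cong) (simp flip: ennreal_mult)
        also have "\<dots> = ennreal (1 / \<theta>) * (\<integral>\<^sup>+x. ennreal ((d x - g (\<theta> * x))\<^sup>2 * (\<theta> * f (\<theta> * x))) \<partial>lborel)"
          by (rule nn_integral_cmult) measurable
        also have "\<dots> \<le> ennreal (1 / \<theta>) * ennreal R"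
          using R[OF \<theta>] by (intro mult_left_mono) auto
        finally show ?thesis using True by (simp add: mult.commute)
      qed simp
    qed
    also have "\<dots> = ennreal R * ennreal (2 * N)"
      using nn_integral_inverse_exp_interval[of N] N \<open>K \<ge> 0\<close>
      by (subst nn_integral_cmult) auto
    finally have "ennreal (v * (2 * (N - K))) \<le> ennreal (R * (2 * N))"
      using assms N by (simp add: ennreal_mult)
    then have "v * (2 * (N - K)) \<le> R * (2 * N)"
      using \<open>R \<ge> 0\<close> \<open>K \<ge> 0\<close> N by (subst (asm) ennreal_le_iff) auto
    then show ?thesis by (simp add: algebra_simps)
  qed
  show ?thesis
  proof (rule ccontr)
    assume "\<not> v \<le> R"
    then have "v - R > 0" by simp
    \<comment> \<open>Chosen so that \<open>(v - R) * (N - K)\<close> exceeds \<open>R * K\<close> by 1.\<close>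
    define N where "N = K + (R * K + 1) / (v - R)"
    have "N \<ge> K" using \<open>v - R > 0\<close> assms by (simp add: N_def)
    from main[OF this] have "(v - R) * (N - K) \<le> R * K" by (simp add: algebra_simps)
    moreover have "(v - R) * (N - K) = R * K + 1" using \<open>v - R > 0\<close> by (simp add: N_def)
    ultimately show False by simp
  qed
qed

text \<open>Truncation to \<open>[exp (-n), exp n]\<close> brings the minimal loss arbitrarily close to the variance,
  and the averaging argument shows that a finite maximal risk cannot lie below it.\<close>

lemma scale_family_minimax_lower_bound:
  fixes f g d :: "real \<Rightarrow> real"
  assumes [measurable]: "f \<in> borel_measurable borel" "g \<in> borel_measurable borel" "d \<in> borel_measurable borel"
    and f: "\<And>t. f t \<ge> 0" and f0: "\<And>t. t \<le> 0 \<Longrightarrow> f t = 0"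
    and prob: "prob_space (density lborel f)"
    and sq: "integrable (density lborel f) (\<lambda>t. (g t)\<^sup>2)"
    and P: "\<And>\<theta>. \<theta> > 0 \<Longrightarrow> P \<theta> = density lborel (\<lambda>x. ennreal (\<theta> * f (\<theta> * x)))"
    and L: "\<And>\<theta> x. \<theta> > 0 \<Longrightarrow> L \<theta> x = g (\<theta> * x)"
  shows "ennreal (prob_space.variance (density lborel f) g) \<le> (SUP \<theta>\<in>{0<..}. risk P L \<theta> d)"
proof (cases "SUP \<theta>\<in>{0<..}. risk P L \<theta> d")
  case (real R)
  have le_R: "risk P L \<theta> d \<le> ennreal R" if "\<theta> > 0" for \<theta>
    unfolding real(2) [symmetric] using that by (intro SUP_upper) auto
  have "prob_space.variance (density lborel f) g \<le> R"
  proof (rule dense_le)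
    fix v assume v: "v < prob_space.variance (density lborel f) g"
    show "v \<le> R"
    proof (cases "v \<ge> 0")
      case True
      let ?A = "\<lambda>n::nat. {exp (- real n)..exp (real n)}"
      have "\<exists>n. \<forall>a. ennreal v \<le> (\<integral>\<^sup>+t. ennreal ((a - g t)\<^sup>2) * indicator (?A n) t \<partial>density lborel f)"
      proof (rule truncated_square_loss_approximates_variance[OF prob _ _ sq _ _ v])
        show "incseq ?A" by (intro incseq_SucI) (auto intro: order_trans)
        have "t \<in> (\<Union>n. ?A n)" if "t > 0" for t
        proof -
          obtain n where "\<bar>ln t\<bar> \<le> real n" using real_arch_simple by blast
          then have "exp (- real n) \<le> exp (ln t)" "exp (ln t) \<le> exp (real n)"
            unfolding exp_le_cancel_iff by auto
          then show ?thesis using that by auto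
        qed
        moreover have "t > 0" if "0 < ennreal (f t)" for t
          using f0[of t] that by (cases "t > 0") auto
        ultimately show "AE t in density lborel f. t \<in> (\<Union>n. ?A n)"
          by (subst AE_density) (simp, intro AE_I2 impI, blast)
      qed auto
      then obtain n where n: "\<And>a. ennreal v \<le>
          (\<integral>\<^sup>+t. ennreal ((a - g t)\<^sup>2) * indicator (?A n) t \<partial>density lborel f)" by blast
      show ?thesis
      proof (rule scale_family_average_risk_bound[where f = f and g = g and d = d and K = "real n"])
        fix a
        have "(\<integral>\<^sup>+t. ennreal ((a - g t)\<^sup>2) * indicator (?A n) t \<partial>density lborel f)
            = (\<integral>\<^sup>+t. ennreal (f t) * (ennreal ((a - g t)\<^sup>2) * indicator (?A n) t) \<partial>lborel)"
          by (rule nn_integral_density) measurable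
        also have "\<dots> = (\<integral>\<^sup>+t. ennreal ((a - g t)\<^sup>2 * f t) * indicator (?A n) t \<partial>lborel)"
          using f by (intro nn_integral_cong) (auto simp: ennreal_mult ac_simps)
        finally show "ennreal v \<le> (\<integral>\<^sup>+t. ennreal ((a - g t)\<^sup>2 * f t) * indicator (?A n) t \<partial>lborel)"
          using n[of a] by simp
      next
        fix \<theta> :: real assume "\<theta> > 0"
        then show "(\<integral>\<^sup>+x. ennreal ((d x - g (\<theta> * x))\<^sup>2 * (\<theta> * f (\<theta> * x))) \<partial>lborel) \<le> ennreal R"
          using le_R[of \<theta>] scale_family_risk[of f g d P \<theta> L] f P L by simp
      qed (use f True real in auto)
    qed (use real in auto)
  qed
  then show ?thesis using real by (auto intro: ennreal_leI)
next
  case top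
  then show ?thesis by (simp only: top_greatest)
qed

section \<open>Minimaxity of the generalized Bayes estimator\<close>

theorem theorem6:
  fixes \<alpha> m k :: real
    and first_stage Lhat :: "real \<Rightarrow> real"
    and L :: "real \<Rightarrow> real \<Rightarrow> real"
  assumes "\<alpha> > 0" and "m \<noteq> 0" and "\<alpha> > 2 * m"
    and "k = (Gamma \<alpha> / Gamma (\<alpha> - m)) powr (1 / m)"
    and "first_stage = (\<lambda>x. k / x)"
    and "L = (\<lambda>\<theta> x. rho m (first_stage x / \<theta>))"
    and "Lhat = (\<lambda>x. m * Digamma \<alpha> + ln (Gamma (\<alpha> - m) / Gamma \<alpha>))"
  shows "is_generalized_bayes (\<lambda>\<theta>. 1 / \<theta>) (gamma_density \<alpha>) {0<..} {0<..} L Lhat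
    \<and> is_minimax (gamma_distribution \<alpha>) L {0<..} Lhat
    \<and> enn2ereal (minimax_risk (gamma_distribution \<alpha>) L {0<..}) =
        ereal (k powr (2 * m) * (Gamma (\<alpha> - 2 * m) / Gamma \<alpha> - (Gamma (\<alpha> - m) / Gamma \<alpha>)\<^sup>2)
          + m\<^sup>2 * deriv Digamma \<alpha>
          + 2 * m * k powr m * (Gamma (\<alpha> - m) / Gamma \<alpha>) * (Digamma (\<alpha> - m) - Digamma \<alpha>))"
proof -
  define M where "M = gamma_distribution \<alpha> 1"
  define f where "f = gamma_density \<alpha> 1"
  define g where "g = (\<lambda>t. rho m (k / t))"
  define V where "V = prob_space.variance M g"
  have M: "M = density lborel f" by (simp add: M_def f_def gamma_distribution_def)
  have prob: "prob_space M" unfolding M_def using assms by (intro prob_space_gamma_distribution) auto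
  have [measurable]: "f \<in> borel_measurable borel" "g \<in> borel_measurable borel"
    unfolding f_def g_def rho_def by measurable
  have f: "f t \<ge> 0" "t \<le> 0 \<Longrightarrow> f t = 0" for t
    using gamma_density_nonneg[OF assms(1)] by (auto simp: f_def gamma_density_def)
  have L: "L \<theta> x = g (\<theta> * x)" for \<theta> x
    by (simp add: assms g_def mult.commute)
  have lik: "gamma_density \<alpha> \<theta> x = \<theta> * f (\<theta> * x)" if "\<theta> > 0" for \<theta> x
    unfolding f_def by (rule gamma_density_scale[OF that])
  have P: "gamma_distribution \<alpha> \<theta> = density lborel (\<lambda>x. ennreal (\<theta> * f (\<theta> * x)))" if "\<theta> > 0" for \<theta>
    unfolding gamma_distribution_def lik[OF that] ..
  note mom = first_stage_loss_moments[OF assms(1-4), folded M_def, folded g_def]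
  have sq: "integrable M (\<lambda>t. (g t)\<^sup>2)"
    using mom(1) by (simp add: g_def)
  have Lhat: "Lhat = (\<lambda>_. prob_space.expectation M g)" using mom(2) assms(7) by simp
  have loss: "(\<integral>\<^sup>+t. ennreal ((a - g t)\<^sup>2) \<partial>M) = ennreal (V + (a - prob_space.expectation M g)\<^sup>2)" for a
    unfolding V_def by (rule nn_integral_square_loss[OF prob _ sq]) (simp add: M)
  have V: "V \<ge> 0" unfolding V_def by (rule prob_space.variance_positive[OF prob])

  have "is_generalized_bayes (\<lambda>\<theta>. 1 / \<theta>) (gamma_density \<alpha>) {0<..} {0<..} L Lhat"
    unfolding is_generalized_bayes_def
  proof (intro conjI ballI allI)
    fix x a :: real assume x: "x \<in> {0<..}"
    have marg: "marginal (\<lambda>\<theta>. 1 / \<theta>) (gamma_density \<alpha>) {0<..} x = ennreal (1 / x)"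
      by (rule marginal_scale_family[of f]) (use f lik prob x in \<open>auto simp: M\<close>)
    have post: "posterior_loss (\<lambda>\<theta>. 1 / \<theta>) (gamma_density \<alpha>) {0<..} L x a
        = ennreal (V + (a - prob_space.expectation M g)\<^sup>2)" for a
      using posterior_loss_scale_family[of f g "gamma_density \<alpha>" x L a] f lik prob x L loss[of a]
      by (simp add: M)
    show "0 < marginal (\<lambda>\<theta>. 1 / \<theta>) (gamma_density \<alpha>) {0<..} x"
      "marginal (\<lambda>\<theta>. 1 / \<theta>) (gamma_density \<alpha>) {0<..} x < \<infinity>"
      using x by (auto simp: marg)
    show "posterior_loss (\<lambda>\<theta>. 1 / \<theta>) (gamma_density \<alpha>) {0<..} L x (Lhat x) < \<infinity>"
      by (simp add: post)
    show "posterior_loss (\<lambda>\<theta>. 1 / \<theta>) (gamma_density \<alpha>) {0<..} L x (Lhat x)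
        \<le> posterior_loss (\<lambda>\<theta>. 1 / \<theta>) (gamma_density \<alpha>) {0<..} L x a"
      unfolding post by (intro ennreal_leI) (simp add: Lhat)
  qed (simp add: Lhat)

  moreover
  have "risk (gamma_distribution \<alpha>) L \<theta> Lhat = ennreal V" if "\<theta> \<in> {0<..}" for \<theta>
    using that loss[of "prob_space.expectation M g"]
      scale_family_risk_const[of f g "gamma_distribution \<alpha>" \<theta> L "prob_space.expectation M g"] f P L
    by (simp add: M Lhat)
  then have sup: "(SUP \<theta>\<in>{0<..}. risk (gamma_distribution \<alpha>) L \<theta> Lhat) = ennreal V"
    by simp
  have lower: "ennreal V \<le> (SUP \<theta>\<in>{0<..}. risk (gamma_distribution \<alpha>) L \<theta> d)"
    if "d \<in> borel_measurable borel" for d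
    unfolding V_def M
    by (rule scale_family_minimax_lower_bound) (use that f P L prob sq in \<open>auto simp: M\<close>)
  have mm: "minimax_risk (gamma_distribution \<alpha>) L {0<..} = ennreal V"
    unfolding minimax_risk_def
  proof (rule antisym)
    show "(INF d\<in>borel_measurable borel. SUP \<theta>\<in>{0<..}. risk (gamma_distribution \<alpha>) L \<theta> d) \<le> ennreal V"
      unfolding sup [symmetric] by (rule INF_lower) (simp add: Lhat)
  qed (intro INF_greatest lower)
  then have "is_minimax (gamma_distribution \<alpha>) L {0<..} Lhat"
    unfolding is_minimax_def using sup by (simp add: Lhat)

  moreover have "enn2ereal (minimax_risk (gamma_distribution \<alpha>) L {0<..}) = ereal V"
    using V by (simp add: mm)
  moreover have "V = k powr (2 * m) * (Gamma (\<alpha> - 2 * m) / Gamma \<alpha> - (Gamma (\<alpha> - m) / Gamma \<alpha>)\<^sup>2)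
      + m\<^sup>2 * deriv Digamma \<alpha>
      + 2 * m * k powr m * (Gamma (\<alpha> - m) / Gamma \<alpha>) * (Digamma (\<alpha> - m) - Digamma \<alpha>)"
    unfolding V_def g_def by (rule mom(3)[unfolded g_def])
  ultimately show ?thesis
    by simp
qed

end
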